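(* Let $P,R$ be finite index sets and let $\mu_p>0$, $\sigma_p^2\ge 0$ $(p\in P)$, $\lambda_r\ge 0$ $(r\in R)$ and $U_{p,r}\ge 0$ $(p\in P,r\in R)$ be given constants. Let $X=(X_p)_{p\in P}$ and $Y=(Y_{p,r})_{p\in P,r\in R}$ be decision variables satisfying $$\sum_{p\in P}\sum_{r\in R}\lambda_rY_{p,r}\le\sum_{p\in P}\mu_pX_p,\qquad \sum_{p\in P}X_p=1,\qquad X_p\in\{0,1\}\ (p\in P),\qquad 0\le Y_{p,r}\le U_{p,r}X_p\ (p\in P,\ r\in R),$$ and let $RH$ be a constant, a variable, or any affine function of the decision variables. Let $PM(X,Y)$ be the expected number of people in the system $L$ (equivalently, the expected total waiting time in the system $TW$) of the M/G/1 queue with arrival rate $\lambda=\sum_{p\in P}\sum_{r\in R}\lambda_rY_{p,r}$, service rate $\mu=\sum_{p\in P}\mu_pX_p$ and service-time variance $\sigma^2=\sum_{p\in P}\sigma_p^2X_p$. Then: (a) The constraint $PM(X,Y)\le RH$ can be represented by the following constraints with auxiliary real variables $r_p$, $p\in P$ (that is, it holds if and only if there exist such $r_p$ satisfying them): $$\sum_{p\in P}\left[\frac{(1+\mu_p^2\sigma_p^2)\,r_p}{2\mu_p}+\frac{\sum_{r\in R}\lambda_rY_{p,r}}{\mu_p}\right]\le RH,$$ $$\Big(\sum_{r\in R}\lambda_rY_{p,r}\Big)^2\le r_p\Big(\mu_p-\sum_{r\in R}\lambda_rY_{p,r}\Big)\ (p\in P),\qquad r_p\ge0\ (p\in P).$$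 (b) Equivalently, the constraint $PM(X,Y)\le RH$ can be represented, in the same sense, by the following constraints with auxiliary real variables $s_p$, $p\in P$: $$\sum_{p\in P}\left[\frac{(1+\mu_p^2\sigma_p^2)\,s_p}{2\mu_p}+\frac{(1-\mu_p^2\sigma_p^2)\sum_{r\in R}\lambda_rY_{p,r}}{2\mu_p}\right]\le RH,$$ $$\Big(\sum_{r\in R}\lambda_rY_{p,r}\Big)^2\le\Big(s_p\mu_p-\sum_{r\in R}\lambda_rY_{p,r}\Big)\Big(\mu_p-\sum_{r\in R}\lambda_rY_{p,r}\Big)\ (p\in P),\qquad s_p\ge0\ (p\in P).$$ (c) Moreover, in the case that the $Y_{p,r}$, $p\in P$, $r\in R$, are binary variables, the constraint $PM(X,Y)\le RH$ can also be represented, in the same sense, by the following constraints with auxiliary real variables $s_p$, $p\in P$: $$\sum_{p\in P}\left[\frac{(1+\mu_p^2\sigma_p^2)\,s_p}{2\mu_p}+\frac{(1-\mu_p^2\sigma_p^2)\sum_{r\in R}\lambda_rY_{p,r}}{2\mu_p}\right]\le RH,$$ $$\sum_{r\in R}\lambda_rY_{p,r}^2\le s_p\Big(\mu_p-\sum_{r\in R}\lambda_rY_{p,r}\Big)\ (p\in P),\qquad s_p\ge0\ (p\in P).$$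
   Context: An M/G/1 queue is a single-server queue with Poisson arrivals of rate $\lambda$ and independent, identically distributed service times with general distribution, mean $1/\mu$ ($\mu$ is the service rate) and variance $\sigma^2$. With $\rho=\lambda/\mu$, and under the standing stability assumption $\rho<1$, the expected number of people in the system $L$ and the expected total waiting time in the system $TW$ are given by $$L=TW=\rho+\frac{\rho^2+\lambda^2\sigma^2}{2(1-\rho)}.$$
   Formalization: In (b) and (c) the coefficient of s_p in the linear constraint is (1+μ_p²σ_p²)/2 instead of the printed (1+μ_p²σ_p²)/(2μ_p), with which (b) and (c) fail (e.g. one server, μ=2, σ²=0, λ=Y=1, RH=1/2, s=1); PM is taken as infinite when λ=μ. *)

theory Defs
  imports Complex_Main "HOL-Library.Extended_Real"
begin

text \<open>
  Mean number in system of an M/G/1 queue with arrival rate \<open>l\<close>, service rate \<open>\<mu>\<close> and service-time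
  variance \<open>v\<close>, by the Pollaczek--Khinchine formula. The formula is meaningful only for
  \<open>l / \<mu> < 1\<close>; without stability the mean is infinite.
\<close>
definition mg1_L :: "real \<Rightarrow> real \<Rightarrow> real \<Rightarrow> ereal" where
  "mg1_L l \<mu> v =
     (let \<rho> = l / \<mu>
      in if \<rho> < 1 then ereal (\<rho> + (\<rho>\<^sup>2 + l\<^sup>2 * v) / (2 * (1 - \<rho>))) else \<infinity>)"

text \<open>
  Expected total waiting time in the system, summed over the customers arriving per unit of time
  (not the mean sojourn time \<open>W\<close> of one customer). Its value is \<open>l * W\<close>, which is the mean number
  in system by Little's law; the model specifies both measures by the same formula.
\<close>
definition mg1_TW :: "real \<Rightarrow> real \<Rightarrow> real \<Rightarrow> ereal" where
  "mg1_TW l \<mu> v = mg1_L l \<mu> v"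

definition load :: "'r set \<Rightarrow> ('r \<Rightarrow> real) \<Rightarrow> ('p \<Rightarrow> 'r \<Rightarrow> real) \<Rightarrow> 'p \<Rightarrow> real" where
  "load R lam Y p = (\<Sum>r\<in>R. lam r * Y p r)"

definition feasible ::
  "'p set \<Rightarrow> 'r set \<Rightarrow> ('p \<Rightarrow> real) \<Rightarrow> ('r \<Rightarrow> real) \<Rightarrow> ('p \<Rightarrow> 'r \<Rightarrow> real)
    \<Rightarrow> ('p \<Rightarrow> real) \<Rightarrow> ('p \<Rightarrow> 'r \<Rightarrow> real) \<Rightarrow> bool" where
  "feasible P R \<mu> lam U X Y \<longleftrightarrow>
     (\<Sum>p\<in>P. \<Sum>r\<in>R. lam r * Y p r) \<le> (\<Sum>p\<in>P. \<mu> p * X p) \<and>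
     (\<Sum>p\<in>P. X p) = 1 \<and>
     (\<forall>p\<in>P. X p \<in> {0, 1}) \<and>
     (\<forall>p\<in>P. \<forall>r\<in>R. 0 \<le> Y p r \<and> Y p r \<le> U p r * X p)"

text \<open>
  Affine expressions in the decision variables \<open>X\<close>, \<open>Y\<close> and further real variables \<open>Z\<close> indexed by
  \<open>V\<close>. A constant has all coefficients zero; a single extra variable is the case of
  one unit coefficient in \<open>d\<close>.
\<close>
definition affine_rhs ::
  "'p set \<Rightarrow> 'r set \<Rightarrow> 'v set
    \<Rightarrow> (('p \<Rightarrow> real) \<Rightarrow> ('p \<Rightarrow> 'r \<Rightarrow> real) \<Rightarrow> ('v \<Rightarrow> real) \<Rightarrow> real) \<Rightarrow> bool" where
  "affine_rhs P R V RH \<longleftrightarrow>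
     (\<exists>c a b d. \<forall>X Y Z. RH X Y Z =
        c + (\<Sum>p\<in>P. a p * X p) + (\<Sum>p\<in>P. \<Sum>r\<in>R. b p r * Y p r) + (\<Sum>k\<in>V. d k * Z k))"

end

(*
  Exactly one server q is selected, and every other server carries no load, so each of the
  separable constraint systems collapses to its q-th component. Write l for the load of q, m for
  its rate and c = 1 + m^2 * sigma^2. The Pollaczek--Khinchine value is then
  l / m + c / (2 * m) * (l^2 / (m - l)), and the auxiliary variable r majorises l^2 / (m - l); the
  rotated cone constraint l^2 <= r * (m - l) has no solution at l = m > 0, which is the
  unstable case. Part (b) is the substitution r = s * m - l, and for binary Y the cone
  constraint of (b) divided by m is that of (c).
*)

theory Submission imports Defs begin

text \<open>Components other than \<open>q\<close> can only add to the sum, so they may be dropped;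
  conversely they may be set to 0, which is admissible and costs nothing. This reduces each system
  of the theorem to one scalar existence statement.\<close>

lemma ex_separable_iff:
  fixes f :: "'p \<Rightarrow> real \<Rightarrow> real"
  assumes "finite P" and q: "q \<in> P"
    and nonneg: "\<And>p t. p \<in> P \<Longrightarrow> p \<noteq> q \<Longrightarrow> C p t \<Longrightarrow> 0 \<le> f p t"
    and zero: "\<And>p. p \<in> P \<Longrightarrow> p \<noteq> q \<Longrightarrow> C p 0 \<and> f p 0 = 0"
  shows "(\<exists>s. (\<Sum>p\<in>P. f p (s p)) \<le> B \<and> (\<forall>p\<in>P. C p (s p))) \<longleftrightarrow> (\<exists>t. f q t \<le> B \<and> C q t)"
    (is "?L \<longleftrightarrow> ?R")
proof
  assume ?L
  then obtain s where s: "(\<Sum>p\<in>P. f p (s p)) \<le> B" "\<And>p. p \<in> P \<Longrightarrow> C p (s p)"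
    by blast
  have "0 \<le> (\<Sum>p\<in>P - {q}. f p (s p))"
    by (rule sum_nonneg) (use nonneg s(2) in blast)
  with s(1) have "f q (s q) \<le> B"
    by (simp add: sum.remove[OF assms(1,2)])
  with s(2) q show ?R
    by blast
next
  assume ?R
  then obtain t where t: "f q t \<le> B" "C q t"
    by blast
  define s where "s = (\<lambda>p. if p = q then t else 0)"
  have "(\<Sum>p\<in>P - {q}. f p (s p)) = 0"
    by (rule sum.neutral) (use zero in \<open>auto simp: s_def\<close>)
  then have "(\<Sum>p\<in>P. f p (s p)) \<le> B"
    using t(1) by (simp add: sum.remove[OF assms(1,2)] s_def)
  moreover have "\<forall>p\<in>P. C p (s p)"
    using t(2) zero by (auto simp: s_def)
  ultimately show ?L
    by blast
qed

text \<open>This form isolates \<open>l^2 / (m - l)\<close>, the quantity bounded by the cone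
  constraint.\<close>

lemma mg1_L_eq:
  assumes "0 < m" "l < m"
  shows "mg1_L l m v = ereal ((1 + m\<^sup>2 * v) * (l\<^sup>2 / (m - l)) / (2 * m) + l / m)"
proof -
  have "((l / m)\<^sup>2 + l\<^sup>2 * v) / (2 * (1 - l / m)) = (1 + m\<^sup>2 * v) * (l\<^sup>2 / (m - l)) / (2 * m)"
  proof -
    have "1 - l / m = (m - l) / m"
      using assms by (simp add: field_simps)
    moreover have "(l / m)\<^sup>2 + l\<^sup>2 * v = (1 + m\<^sup>2 * v) * l\<^sup>2 / m\<^sup>2"
      using assms by (simp add: field_simps)
    ultimately show ?thesis
      using assms by (simp add: power2_eq_square)
  qed
  then show ?thesis
    using assms by (simp add: mg1_L_def Let_def)
qed

text \<open>The coefficient of \<open>t\<close> is nonnegative, so feasibility is decided by the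
  least \<open>t\<close> that the cone allows.\<close>

lemma mg1_L_le_iff:
  assumes "0 < m" "0 \<le> v" "l \<le> m"
  shows "mg1_L l m v \<le> ereal B \<longleftrightarrow>
    (\<exists>t. (1 + m\<^sup>2 * v) * t / (2 * m) + l / m \<le> B \<and> l\<^sup>2 \<le> t * (m - l) \<and> 0 \<le> t)"
proof (cases "l < m")
  \<comment> \<open>In the critical case \<open>l = m\<close> both sides are false: the mean is
    infinite and the cone would require \<open>m^2 \<le> 0\<close>.\<close>
  case False
  with assms have "l = m"
    by simp
  with \<open>0 < m\<close> show ?thesis
    by (simp add: mg1_L_def)
next
  case True
  define t0 where "t0 = l\<^sup>2 / (m - l)"
  have cone: "l\<^sup>2 \<le> t * (m - l) \<longleftrightarrow> t0 \<le> t" for t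
    using True by (simp add: t0_def pos_divide_le_eq)
  have "0 \<le> t0"
    using True by (simp add: t0_def)
  have mono: "(1 + m\<^sup>2 * v) * t0 / (2 * m) \<le> (1 + m\<^sup>2 * v) * t / (2 * m)" if "t0 \<le> t" for t
    using that assms by (intro divide_right_mono mult_left_mono) auto
  have "mg1_L l m v \<le> ereal B \<longleftrightarrow> (1 + m\<^sup>2 * v) * t0 / (2 * m) + l / m \<le> B"
    using mg1_L_eq[OF \<open>0 < m\<close> True] by (simp add: t0_def)
  also have "\<dots> \<longleftrightarrow> (\<exists>t. (1 + m\<^sup>2 * v) * t / (2 * m) + l / m \<le> B \<and> l\<^sup>2 \<le> t * (m - l) \<and> 0 \<le> t)"
    unfolding cone using \<open>0 \<le> t0\<close> mono by (force intro: order_trans)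
  finally show ?thesis .
qed

text \<open>Obtained from \<open>mg1_L_le_iff\<close> by \<open>t = s * m - l\<close>. The factor
  \<open>m\<close> cancels in the term with \<open>s\<close>, which is therefore divided by
  \<open>2\<close>, not by \<open>2 * m\<close> as in the informal statements of (b) and
  (c).\<close>

lemma mg1_L_le_iff':
  assumes "0 < m" "0 \<le> v" "0 \<le> l" "l \<le> m"
  shows "mg1_L l m v \<le> ereal B \<longleftrightarrow>
    (\<exists>s. (1 + m\<^sup>2 * v) * s / 2 + (1 - m\<^sup>2 * v) * l / (2 * m) \<le> B
      \<and> l\<^sup>2 \<le> (s * m - l) * (m - l) \<and> 0 \<le> s)"
proof -
  have val: "(1 + m\<^sup>2 * v) * (s * m - l) / (2 * m) + l / m
      = (1 + m\<^sup>2 * v) * s / 2 + (1 - m\<^sup>2 * v) * l / (2 * m)" for s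
    using \<open>0 < m\<close> by (simp add: field_simps)
  \<comment> \<open>The substitution turns \<open>0 \<le> t\<close> into
    \<open>0 \<le> s * m - l\<close>. Under the cone constraint this and \<open>0 \<le> s\<close>
    both hold, so either sign condition may stand for the other.\<close>
  have nonneg: "0 \<le> s * m - l \<longleftrightarrow> 0 \<le> s" if cone: "l\<^sup>2 \<le> (s * m - l) * (m - l)" for s
  proof -
    have "l \<noteq> m"
      using cone \<open>0 < m\<close> by auto
    then have "0 < m - l"
      using assms by simp
    moreover have "0 \<le> (s * m - l) * (m - l)"
      using cone by (rule order_trans[OF zero_le_power2])
    ultimately have "0 \<le> s * m - l"
      by (simp add: zero_le_mult_iff)
    moreover from this have "0 \<le> s * m"
      using \<open>0 \<le> l\<close> by simp
    ultimately show ?thesis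
      using \<open>0 < m\<close> by (simp add: zero_le_mult_iff)
  qed
  have "mg1_L l m v \<le> ereal B \<longleftrightarrow>
      (\<exists>t. (1 + m\<^sup>2 * v) * t / (2 * m) + l / m \<le> B \<and> l\<^sup>2 \<le> t * (m - l) \<and> 0 \<le> t)"
    (is "_ \<longleftrightarrow> (\<exists>t. ?\<Phi> t)")
    using assms by (intro mg1_L_le_iff) auto
  also have "\<dots> \<longleftrightarrow> (\<exists>s. ?\<Phi> (s * m - l))"
  proof
    assume "\<exists>t. ?\<Phi> t"
    then obtain t where t: "?\<Phi> t" ..
    \<comment> \<open>The substitution is onto: \<open>s = (t + l) / m\<close> inverts it.\<close>
    have "(t + l) / m * m - l = t"
      using \<open>0 < m\<close> by simp
    with t have "?\<Phi> ((t + l) / m * m - l)"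
      by (simp only:)
    then show "\<exists>s. ?\<Phi> (s * m - l)" ..
  qed blast
  also have "\<dots> \<longleftrightarrow> (\<exists>s. (1 + m\<^sup>2 * v) * s / 2 + (1 - m\<^sup>2 * v) * l / (2 * m) \<le> B
      \<and> l\<^sup>2 \<le> (s * m - l) * (m - l) \<and> 0 \<le> s)"
    unfolding val using nonneg by blast
  finally show ?thesis .
qed

text \<open>The \<open>l^2\<close> terms cancel, and the remaining difference is divisible by
  \<open>m\<close>. The right-hand side is linear in the numerator load, as needed for binary
  \<open>Y\<close>.\<close>

lemma cone_iff:
  fixes l m s :: real
  assumes "0 < m"
  shows "l\<^sup>2 \<le> (s * m - l) * (m - l) \<longleftrightarrow> l \<le> s * (m - l)"
proof -
  have "(s * m - l) * (m - l) - l\<^sup>2 = m * (s * (m - l) - l)"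
    by (simp add: algebra_simps power2_eq_square)
  then have "l\<^sup>2 \<le> (s * m - l) * (m - l) \<longleftrightarrow> 0 \<le> m * (s * (m - l) - l)"
    by linarith
  also have "\<dots> \<longleftrightarrow> l \<le> s * (m - l)"
    using assms by (simp add: zero_le_mult_iff)
  finally show ?thesis .
qed

lemma sum_binary_eq_1E:
  fixes X :: "'p \<Rightarrow> real"
  assumes "finite P" and one: "sum X P = 1" and bin: "\<forall>p\<in>P. X p \<in> {0, 1}"
  obtains q where "q \<in> P" "X q = 1" "\<And>p. p \<in> P \<Longrightarrow> p \<noteq> q \<Longrightarrow> X p = 0"
proof -
  obtain q where q: "q \<in> P" "X q \<noteq> 0"
    using one sum.neutral[of P X] by (metis zero_neq_one)
  with bin have Xq: "X q = 1"
    by auto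
  with one have "sum X (P - {q}) = 0"
    by (simp add: sum.remove[OF \<open>finite P\<close> q(1)])
  moreover have "\<forall>p\<in>P - {q}. 0 \<le> X p"
    using bin by fastforce
  ultimately have "\<forall>p\<in>P - {q}. X p = 0"
    using \<open>finite P\<close> sum_nonneg_eq_0_iff[of "P - {q}" X] by blast
  with that q Xq show thesis
    by blast
qed

lemma sum_eq_single:
  fixes f :: "'p \<Rightarrow> real"
  assumes "finite P" "q \<in> P" "\<And>p. p \<in> P \<Longrightarrow> p \<noteq> q \<Longrightarrow> f p = 0"
  shows "sum f P = f q"
  using sum.mono_neutral_right[of P "{q}" f] assms by auto

theorem theorem1:
  fixes P :: "'p set" and R :: "'r set" and V :: "'v set"
    and \<mu> \<sigma>2 :: "'p \<Rightarrow> real" and lam :: "'r \<Rightarrow> real" and U :: "'p \<Rightarrow> 'r \<Rightarrow> real"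
    and RH :: "('p \<Rightarrow> real) \<Rightarrow> ('p \<Rightarrow> 'r \<Rightarrow> real) \<Rightarrow> ('v \<Rightarrow> real) \<Rightarrow> real"
    and Q :: "real \<Rightarrow> real \<Rightarrow> real \<Rightarrow> ereal"
    and PM :: "('p \<Rightarrow> real) \<Rightarrow> ('p \<Rightarrow> 'r \<Rightarrow> real) \<Rightarrow> ereal"
    and X :: "'p \<Rightarrow> real" and Y :: "'p \<Rightarrow> 'r \<Rightarrow> real" and Z :: "'v \<Rightarrow> real"
  assumes "finite P" and "finite R" and "finite V"
    and "\<And>p. p \<in> P \<Longrightarrow> \<mu> p > 0"
    and "\<And>p. p \<in> P \<Longrightarrow> \<sigma>2 p \<ge> 0"
    and "\<And>r. r \<in> R \<Longrightarrow> lam r \<ge> 0"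
    and "\<And>p r. p \<in> P \<Longrightarrow> r \<in> R \<Longrightarrow> U p r \<ge> 0"
    and "affine_rhs P R V RH"
    and "Q \<in> {mg1_L, mg1_TW}"
    and "PM = (\<lambda>X Y. Q (\<Sum>p\<in>P. \<Sum>r\<in>R. lam r * Y p r) (\<Sum>p\<in>P. \<mu> p * X p) (\<Sum>p\<in>P. \<sigma>2 p * X p))"
    and "feasible P R \<mu> lam U X Y"
  shows
    "(PM X Y \<le> ereal (RH X Y Z) \<longleftrightarrow>
       (\<exists>r :: 'p \<Rightarrow> real.
          (\<Sum>p\<in>P. (1 + (\<mu> p)\<^sup>2 * \<sigma>2 p) * r p / (2 * \<mu> p) + load R lam Y p / \<mu> p) \<le> RH X Y Z \<and>
          (\<forall>p\<in>P. (load R lam Y p)\<^sup>2 \<le> r p * (\<mu> p - load R lam Y p)) \<and>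
          (\<forall>p\<in>P. r p \<ge> 0)))
     \<and>
     (PM X Y \<le> ereal (RH X Y Z) \<longleftrightarrow>
       (\<exists>s :: 'p \<Rightarrow> real.
          (\<Sum>p\<in>P. (1 + (\<mu> p)\<^sup>2 * \<sigma>2 p) * s p / 2
                  + (1 - (\<mu> p)\<^sup>2 * \<sigma>2 p) * load R lam Y p / (2 * \<mu> p)) \<le> RH X Y Z \<and>
          (\<forall>p\<in>P. (load R lam Y p)\<^sup>2
                  \<le> (s p * \<mu> p - load R lam Y p) * (\<mu> p - load R lam Y p)) \<and>
          (\<forall>p\<in>P. s p \<ge> 0)))
     \<and>
     ((\<forall>p\<in>P. \<forall>r\<in>R. Y p r \<in> {0, 1}) \<longrightarrow>
      (PM X Y \<le> ereal (RH X Y Z) \<longleftrightarrow>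
       (\<exists>s :: 'p \<Rightarrow> real.
          (\<Sum>p\<in>P. (1 + (\<mu> p)\<^sup>2 * \<sigma>2 p) * s p / 2
                  + (1 - (\<mu> p)\<^sup>2 * \<sigma>2 p) * load R lam Y p / (2 * \<mu> p)) \<le> RH X Y Z \<and>
          (\<forall>p\<in>P. (\<Sum>r\<in>R. lam r * (Y p r)\<^sup>2) \<le> s p * (\<mu> p - load R lam Y p)) \<and>
          (\<forall>p\<in>P. s p \<ge> 0))))"
proof -
  let ?l = "load R lam Y" and ?B = "RH X Y Z"
  have feas: "(\<Sum>p\<in>P. ?l p) \<le> (\<Sum>p\<in>P. \<mu> p * X p)" "sum X P = 1" "\<forall>p\<in>P. X p \<in> {0, 1}"
    and Y: "\<And>p r. p \<in> P \<Longrightarrow> r \<in> R \<Longrightarrow> 0 \<le> Y p r \<and> Y p r \<le> U p r * X p"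
    using \<open>feasible P R \<mu> lam U X Y\<close> by (auto simp: feasible_def load_def)
  obtain q where q: "q \<in> P" "X q = 1" and X0: "\<And>p. p \<in> P \<Longrightarrow> p \<noteq> q \<Longrightarrow> X p = 0"
    using sum_binary_eq_1E[OF \<open>finite P\<close> feas(2,3)] by blast
  \<comment> \<open>Here \<open>X p = 0\<close> squeezes every \<open>Y p r\<close> between 0 and
    \<open>U p r * 0\<close>.\<close>
  have l0: "?l p = 0" if "p \<in> P" "p \<noteq> q" for p
    unfolding load_def by (rule sum.neutral) (use Y[OF that(1)] X0[OF that] in force)
  have lq: "0 \<le> ?l q"
    unfolding load_def using Y[OF q(1)] assms(6) by (intro sum_nonneg mult_nonneg_nonneg) auto
  have sums: "(\<Sum>p\<in>P. ?l p) = ?l q" "(\<Sum>p\<in>P. \<mu> p * X p) = \<mu> q" "(\<Sum>p\<in>P. \<sigma>2 p * X p) = \<sigma>2 q"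
    using sum_eq_single[OF \<open>finite P\<close> q(1), of ?l] l0 X0 q(2)
      sum_eq_single[OF \<open>finite P\<close> q(1), of "\<lambda>p. \<mu> p * X p"]
      sum_eq_single[OF \<open>finite P\<close> q(1), of "\<lambda>p. \<sigma>2 p * X p"] by auto
  \<comment> \<open>The capacity constraint permits equality, so the critical load remains a case to
    be handled.\<close>
  have lm: "?l q \<le> \<mu> q"
    using feas(1) by (simp only: sums)
  have "PM X Y = mg1_L (\<Sum>p\<in>P. ?l p) (\<Sum>p\<in>P. \<mu> p * X p) (\<Sum>p\<in>P. \<sigma>2 p * X p)"
    using assms(9,10) by (auto simp: mg1_TW_def load_def)
  then have PM: "PM X Y = mg1_L (?l q) (\<mu> q) (\<sigma>2 q)"
    by (simp only: sums)
  note pos = assms(4)[OF q(1)] assms(5)[OF q(1)]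
  have coeff: "0 \<le> 1 + (\<mu> p)\<^sup>2 * \<sigma>2 p" if "p \<in> P" for p
    using assms(5)[OF that] by simp
  \<comment> \<open>For \<open>p \<noteq> q\<close> the load vanishes: the cost is a nonnegative
    multiple of \<open>t\<close>, and at \<open>t = 0\<close> the cone reads
    \<open>0 \<le> 0\<close>.\<close>
  have a: "PM X Y \<le> ereal ?B \<longleftrightarrow>
      (\<exists>r. (\<Sum>p\<in>P. (1 + (\<mu> p)\<^sup>2 * \<sigma>2 p) * r p / (2 * \<mu> p) + ?l p / \<mu> p) \<le> ?B \<and>
        (\<forall>p\<in>P. (?l p)\<^sup>2 \<le> r p * (\<mu> p - ?l p) \<and> 0 \<le> r p))"
    unfolding PM mg1_L_le_iff[OF pos lm]
    by (rule ex_separable_iff[OF \<open>finite P\<close> q(1), symmetric,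
          where f = "\<lambda>p t. (1 + (\<mu> p)\<^sup>2 * \<sigma>2 p) * t / (2 * \<mu> p) + ?l p / \<mu> p"
            and C = "\<lambda>p t. (?l p)\<^sup>2 \<le> t * (\<mu> p - ?l p) \<and> 0 \<le> t"])
      (use coeff assms(4) l0 in \<open>auto intro!: divide_nonneg_pos mult_nonneg_nonneg\<close>)
  \<comment> \<open>The factor \<open>1 - (\<mu> p)\<^sup>2 * \<sigma>2 p\<close> may be negative,
    but for \<open>p \<noteq> q\<close> it multiplies a zero load, so the cost there is still
    nonnegative.\<close>
  have b: "PM X Y \<le> ereal ?B \<longleftrightarrow>
      (\<exists>s. (\<Sum>p\<in>P. (1 + (\<mu> p)\<^sup>2 * \<sigma>2 p) * s p / 2
          + (1 - (\<mu> p)\<^sup>2 * \<sigma>2 p) * ?l p / (2 * \<mu> p)) \<le> ?B \<and>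
        (\<forall>p\<in>P. (?l p)\<^sup>2 \<le> (s p * \<mu> p - ?l p) * (\<mu> p - ?l p) \<and> 0 \<le> s p))"
    unfolding PM mg1_L_le_iff'[OF pos lq lm]
    by (rule ex_separable_iff[OF \<open>finite P\<close> q(1), symmetric,
          where f = "\<lambda>p s. (1 + (\<mu> p)\<^sup>2 * \<sigma>2 p) * s / 2
              + (1 - (\<mu> p)\<^sup>2 * \<sigma>2 p) * ?l p / (2 * \<mu> p)"
            and C = "\<lambda>p s. (?l p)\<^sup>2 \<le> (s * \<mu> p - ?l p) * (\<mu> p - ?l p) \<and> 0 \<le> s"])
      (use coeff l0 in \<open>auto intro!: mult_nonneg_nonneg\<close>)
  have c: "(\<Sum>r\<in>R. lam r * (Y p r)\<^sup>2) \<le> s * (\<mu> p - ?l p) \<longleftrightarrow>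
      (?l p)\<^sup>2 \<le> (s * \<mu> p - ?l p) * (\<mu> p - ?l p)"
    if "\<forall>p\<in>P. \<forall>r\<in>R. Y p r \<in> {0, 1}" "p \<in> P" for p s
  proof -
    \<comment> \<open>Binary values satisfy \<open>y^2 = y\<close>.\<close>
    have "(\<Sum>r\<in>R. lam r * (Y p r)\<^sup>2) = ?l p"
      unfolding load_def by (rule sum.cong) (use that in force)+
    then show ?thesis
      by (simp add: cone_iff[OF assms(4)[OF that(2)]])
  qed
  show ?thesis
    \<comment> \<open>By \<open>c\<close>, the constraints of (b) and (c) agree for the same
      \<open>s\<close>, so (c) follows from \<open>b\<close>.\<close>
    using a b by (simp add: c ball_conj_distrib)
qed

end
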